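(* Let $C_7=\mathbb{Z}/7\mathbb{Z}$, written additively, and put $G_H=C_7\rtimes C_2$ with $C_2$ acting by $x\mapsto -x$, so $|G_H|=14$. Let $v_1=1$, $v_2=3$ in $C_7$ and \[ S_H=\{(v_1,1),(v_1+v_2,1),(v_2,1)\}=\{(1,1),(4,1),(3,1)\}. \] Then: (i) $\operatorname{Cay}(G_H,S_H)$ is the Heawood graph; it is connected, bipartite, and trivalent of girth $6$. (ii) It is the smallest nondegenerate honeycomb quotient arising from a finite-index sublattice of $\mathbb{Z}^2$: it is such a nondegenerate quotient (arising from the kernel $N$ of $\mathbb{Z}^2\to C_7$, $(x,y)\mapsto x+3y$), and for every finite-index sublattice $N\subseteq\mathbb{Z}^2$ for which the honeycomb quotient $\operatorname{Cay}(G_N,S_N)$ is nondegenerate one has $|G_N|\geq 14$. (iii) $\operatorname{sep}_4(G_H)=2$ and $\operatorname{csep}_4(G_H,S_H)=4$. In particular $\operatorname{csep}_4(G_H,S_H)=2\operatorname{sep}_4(G_H)$.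
   Context: Generalized dihedral groups: for a finite abelian group $A$ (additive), $A\rtimes C_2$ consists of pairs $(x,\epsilon)$, $x\in A$, $\epsilon\in\{0,1\}$ (modulo $2$), with $(x,\epsilon)(y,\delta)=(x+(-1)^\epsilon y,\epsilon+\delta)$. Honeycomb quotients: for a finite-index sublattice $N\subseteq\mathbb{Z}^2$, put $A_N=\mathbb{Z}^2/N$, $G_N=A_N\rtimes C_2$, and $S_N=\{(v_1,1),(v_1+v_2,1),(v_2,1)\}$, where $v_1,v_2$ are the images in $A_N$ of the standard basis vectors of $\mathbb{Z}^2$. The honeycomb quotient is the graph $\operatorname{Cay}(G_N,S_N)$. It is called nondegenerate when the three elements of $S_N$ are distinct and no hexagonal face collapses, the latter meaning that the graph has no $4$-cycle. $\operatorname{Cay}(G,S)$ is the right Cayley graph: vertices are elements of $G$, with an edge from $g$ to $gs$ for each $s\in S$. Separation: for $q\geq2$ write $[q]=\{0,\ldots,q-1\}$. A pattern is an ordered tuple $Y=(y_1,\ldots,y_k)$ of distinct elements of a finite group $G$, $|Y|=k$ (also identified with its underlying set). For $f:G\to[q]$, $(f,Y)$ is separating if $g\mapsto(f(gy_1),\ldots,f(gy_k))\in[q]^k$ is injective on $G$. Define \[ \operatorname{sep}_q(G)=\min\{|Y|:\exists f:G\to[q] \text{ with } (f,Y)\text{ separating}\}. \] A Cayley window for $(G,S)$ is a pattern $Y\subseteq G$ with $1\in Y$, $S\subseteq Y$, such that the subgraph of $\operatorname{Cay}(G,S)$ induced by $Y$ is connected. Define \[ \operatorname{csep}_q(G,S)=\min\{|Y|: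 Y\text{ is a Cayley window and }\exists f:G\to[q]\text{ with }(f,Y)\text{ separating}\}. \] *)

theory Defs
  imports
    "HOL-Algebra.Elementary_Groups"
    "HOL-Library.Z2"
    "HOL-Library.Product_Plus"
    "HOL-Library.Extended_Nat"
    "Graph_Theory.Graph_Theory"
begin

section \<open>Generalized dihedral groups\<close>

text \<open>The abelian group is written multiplicatively, as everywhere in HOL-Algebra, so
  \<open>x + (-1)^e y\<close> becomes a product with \<open>y\<close> or with its inverse.\<close>

definition gen_dihedral :: "('a, 'b) monoid_scheme \<Rightarrow> ('a \<times> int) monoid" where
  "gen_dihedral A = \<lparr>carrier = carrier A \<times> {0, 1},
     monoid.mult = (\<lambda>(x, e) (y, d).
       (x \<otimes>\<^bsub>A\<^esub> (if e = 0 then y else inv\<^bsub>A\<^esub> y), (e + d) mod 2)),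
     one = (\<one>\<^bsub>A\<^esub>, 0)\<rparr>"

lemma group_gen_dihedral:
  assumes "comm_group A"
  shows "group (gen_dihedral A)"
proof -
  interpret comm_group A by fact
  show ?thesis
  proof (rule groupI)
    fix x assume "x \<in> carrier (gen_dihedral A)"
    then obtain a e where x: "x = (a, e)" "a \<in> carrier A" "e \<in> {0, 1}"
      by (auto simp: gen_dihedral_def)
    have "(if e = 0 then inv\<^bsub>A\<^esub> a else a, e) \<otimes>\<^bsub>gen_dihedral A\<^esub> x = \<one>\<^bsub>gen_dihedral A\<^esub>"
      using x by (auto simp: gen_dihedral_def)
    moreover have "(if e = 0 then inv\<^bsub>A\<^esub> a else a, e) \<in> carrier (gen_dihedral A)"
      using x by (auto simp: gen_dihedral_def)
    ultimately show "\<exists>y\<in>carrier (gen_dihedral A). y \<otimes>\<^bsub>gen_dihedral A\<^esub> x = \<one>\<^bsub>gen_dihedral A\<^esub>"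
      by blast
  qed (auto simp: gen_dihedral_def m_assoc inv_mult)
qed


section \<open>Graphs\<close>

text \<open>Following the library, an undirected graph is a symmetric digraph.  There the closed
  walk \<open>u, v, u\<close> counts as a cycle, so undirected cycles are those of length at least 3.\<close>

definition graph_cycle :: "('a, 'b) pre_digraph \<Rightarrow> 'b awalk \<Rightarrow> bool" where
  "graph_cycle \<Gamma> p \<longleftrightarrow> pre_digraph.cycle \<Gamma> p \<and> 3 \<le> length p"

definition girth :: "('a, 'b) pre_digraph \<Rightarrow> enat" where
  "girth \<Gamma> = Inf {enat (length p) | p. graph_cycle \<Gamma> p}"

definition bipartite :: "('a, 'b) pre_digraph \<Rightarrow> bool" where
  "bipartite \<Gamma> \<longleftrightarrow> (\<exists>U V. verts \<Gamma> = U \<union> V \<and> U \<inter> V = {} \<and>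
     arcs_ends \<Gamma> \<subseteq> U \<times> V \<union> V \<times> U)"

text \<open>In a symmetric digraph the out-degree of a vertex is its degree as an undirected graph.\<close>

definition trivalent :: "('a, 'b) pre_digraph \<Rightarrow> bool" where
  "trivalent \<Gamma> \<longleftrightarrow> (\<forall>v\<in>verts \<Gamma>. out_degree \<Gamma> v = 3)"

text \<open>The Heawood graph is the Levi graph (point-line incidence graph) of the Fano plane.  The
  points of the Fano plane are the nonzero vectors of the three-dimensional space over the field
  with two elements; its lines are the two-dimensional subspaces without the zero vector.\<close>

definition levi_graph :: "'p set \<Rightarrow> 'p set set \<Rightarrow>
    ('p + 'p set, ('p + 'p set) \<times> ('p + 'p set)) pre_digraph" where
  "levi_graph P L = with_proj
     \<lparr>pverts = Inl ` P \<union> Inr ` L,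
      parcs = {(Inl p, Inr l) | p l. p \<in> P \<and> l \<in> L \<and> p \<in> l} \<union>
              {(Inr l, Inl p) | p l. p \<in> P \<and> l \<in> L \<and> p \<in> l}\<rparr>"

definition fano_points :: "(bit \<times> bit \<times> bit) set" where
  "fano_points = UNIV - {0}"

definition fano_lines :: "(bit \<times> bit \<times> bit) set set" where
  "fano_lines = {{p, q, p + q} | p q. p \<in> fano_points \<and> q \<in> fano_points \<and> p \<noteq> q}"

definition heawood_graph where
  "heawood_graph = levi_graph fano_points fano_lines"


section \<open>Cayley graphs\<close>

definition Cay :: "('a, 'b) monoid_scheme \<Rightarrow> 'a set \<Rightarrow> ('a, 'a \<times> 'a) pre_digraph" where
  "Cay G S = with_proj
     \<lparr>pverts = carrier G, parcs = {(g, g \<otimes>\<^bsub>G\<^esub> s) | g s. g \<in> carrier G \<and> s \<in> S}\<rparr>"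

lemma graph_Cay:
  assumes "group G" "finite (carrier G)" "S \<subseteq> carrier G" "\<one>\<^bsub>G\<^esub> \<notin> S"
    and "\<And>s. s \<in> S \<Longrightarrow> inv\<^bsub>G\<^esub> s \<in> S"
  shows "graph (Cay G S)"
proof -
  interpret group G by fact
  let ?E = "{(g, g \<otimes>\<^bsub>G\<^esub> s) | g s. g \<in> carrier G \<and> s \<in> S}"
  have sub: "?E \<subseteq> carrier G \<times> carrier G"
    using assms(3) by auto
  then have fin: "finite ?E"
    using assms(2) by (meson finite_SigmaI finite_subset)
  have "sym ?E"
  proof (rule symI)
    fix a b assume "(a, b) \<in> ?E"
    then obtain s where s: "a \<in> carrier G" "s \<in> S" "b = a \<otimes>\<^bsub>G\<^esub> s" by auto
    moreover have "s \<in> carrier G" using s assms(3) by auto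
    ultimately have "b \<in> carrier G" "a = b \<otimes>\<^bsub>G\<^esub> inv\<^bsub>G\<^esub> s"
      by (auto simp: m_assoc)
    then show "(b, a) \<in> ?E" using s(2) assms(5) by auto
  qed
  moreover have "g \<noteq> g \<otimes>\<^bsub>G\<^esub> s" if "g \<in> carrier G" "s \<in> S" for g s
  proof
    assume "g = g \<otimes>\<^bsub>G\<^esub> s"
    then have "s = \<one>\<^bsub>G\<^esub>" using that assms(3) r_cancel_one' by auto
    then show False using that assms(4) by simp
  qed
  ultimately have "pair_graph \<lparr>pverts = carrier G, parcs = ?E\<rparr>"
    using sub fin assms(2,3) by unfold_locales (auto simp: subset_iff symmetric_def)
  then show ?thesis
    unfolding Cay_def by (rule pair_graph.pair_graphD_graph)
qed


section \<open>Honeycomb quotients\<close>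

definition honeycomb_gens :: "('a, 'b) monoid_scheme \<Rightarrow> 'a \<Rightarrow> 'a \<Rightarrow> ('a \<times> int) set" where
  "honeycomb_gens A v1 v2 = {(v1, 1), (v1 \<otimes>\<^bsub>A\<^esub> v2, 1), (v2, 1)}"

definition Z_squared :: "(int \<times> int) monoid" where
  "Z_squared = integer_group \<times>\<times> integer_group"

definition finite_index_sublattice :: "(int \<times> int) set \<Rightarrow> bool" where
  "finite_index_sublattice N \<longleftrightarrow> subgroup N Z_squared \<and> finite (rcosets\<^bsub>Z_squared\<^esub> N)"

definition honeycomb_group :: "(int \<times> int) set \<Rightarrow> ((int \<times> int) set \<times> int) monoid" where
  "honeycomb_group N = gen_dihedral (Z_squared Mod N)"

definition honeycomb_S :: "(int \<times> int) set \<Rightarrow> ((int \<times> int) set \<times> int) set" where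
  "honeycomb_S N =
     honeycomb_gens (Z_squared Mod N) (N #>\<^bsub>Z_squared\<^esub> (1, 0)) (N #>\<^bsub>Z_squared\<^esub> (0, 1))"

definition honeycomb_quotient where
  "honeycomb_quotient N = Cay (honeycomb_group N) (honeycomb_S N)"

definition nondegenerate :: "(int \<times> int) set \<Rightarrow> bool" where
  "nondegenerate N \<longleftrightarrow> card (honeycomb_S N) = 3 \<and>
     \<not> (\<exists>p. graph_cycle (honeycomb_quotient N) p \<and> length p = 4)"


section \<open>Separation\<close>

definition pattern :: "('a, 'b) monoid_scheme \<Rightarrow> 'a list \<Rightarrow> bool" where
  "pattern G Y \<longleftrightarrow> distinct Y \<and> set Y \<subseteq> carrier G"

definition separating ::
    "('a, 'b) monoid_scheme \<Rightarrow> ('a \<Rightarrow> nat) \<Rightarrow> 'a list \<Rightarrow> bool" where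
  "separating G f Y \<longleftrightarrow> inj_on (\<lambda>g. map (\<lambda>y. f (g \<otimes>\<^bsub>G\<^esub> y)) Y) (carrier G)"

definition cayley_window :: "('a, 'b) monoid_scheme \<Rightarrow> 'a set \<Rightarrow> 'a list \<Rightarrow> bool" where
  "cayley_window G S Y \<longleftrightarrow> pattern G Y \<and> \<one>\<^bsub>G\<^esub> \<in> set Y \<and> S \<subseteq> set Y \<and>
     connected (Cay G S \<restriction> set Y)"

text \<open>The infimum of the empty set of naturals is 0, so a positive value of the following minima
  is attained.  Only the values of \<open>f\<close> on the carrier matter.\<close>

definition sep :: "nat \<Rightarrow> ('a, 'b) monoid_scheme \<Rightarrow> nat" where
  "sep q G = Inf {length Y | Y. pattern G Y \<and>
     (\<exists>f. f ` carrier G \<subseteq> {..<q} \<and> separating G f Y)}"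

definition csep :: "nat \<Rightarrow> ('a, 'b) monoid_scheme \<Rightarrow> 'a set \<Rightarrow> nat" where
  "csep q G S = Inf {length Y | Y. cayley_window G S Y \<and>
     (\<exists>f. f ` carrier G \<subseteq> {..<q} \<and> separating G f Y)}"


section \<open>The group of order 14 and its generators\<close>

definition G_H :: "(int \<times> int) monoid" where
  "G_H = gen_dihedral (integer_mod_group 7)"

definition S_H :: "(int \<times> int) set" where
  "S_H = honeycomb_gens (integer_mod_group 7) 1 3"

definition N_H :: "(int \<times> int) set" where
  "N_H = kernel Z_squared (integer_mod_group 7) (\<lambda>(x, y). (x + 3 * y) mod 7)"

end

theory Submission
  imports Defs
begin

text \<open>For generators \<open>(x, 1)\<close>, \<open>x \<in> X\<close>, a 4-cycle in the Cayley graph of the generalized dihedral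
  group of \<open>A\<close> amounts to an equation \<open>a + c = b + d\<close> in \<open>X\<close> with \<open>a \<noteq> b\<close> and \<open>a \<noteq> d\<close>. So a
  honeycomb quotient is nondegenerate iff \<open>{v1, v1 + v2, v2}\<close> is a Sidon set of size 3. Its six
  differences are then distinct and nonzero, which forces \<open>|A| \<ge> 7\<close>. The set \<open>{1, 3, 4}\<close> in
  \<open>C_7\<close> is a perfect difference set, and Singer's labelling of the Fano plane by powers of a
  generator of the field with 8 elements turns its translates into the lines.
  The lower bounds on the separation numbers are counting: \<open>4 < 14\<close>, and a window contains
  the identity and the three generators.\<close>

section \<open>Sidon sets and cycles in dihedral Cayley graphs\<close>

text \<open>In an abelian group, cancellation turns \<open>a = b\<close> into \<open>c = d\<close>
  and \<open>a = d\<close> into \<open>c = b\<close>, so this is the usual condition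
  \<open>{a, c} = {b, d}\<close>. The two inequalities in its negation become the distinctness of
  opposite vertices of a 4-cycle.\<close>

definition sidon :: "('a, 'b) monoid_scheme \<Rightarrow> 'a set \<Rightarrow> bool" where
  "sidon A X \<longleftrightarrow> (\<forall>a\<in>X. \<forall>b\<in>X. \<forall>c\<in>X. \<forall>d\<in>X.
     a \<otimes>\<^bsub>A\<^esub> c = b \<otimes>\<^bsub>A\<^esub> d \<longrightarrow> a = b \<or> a = d)"

text \<open>The quotient of two distinct elements is not the identity, and by the Sidon property it
  determines the ordered pair. The identity itself supplies the extra 1.\<close>

lemma card_sidon_le_order:
  assumes "comm_group A" "finite (carrier A)" "X \<subseteq> carrier A" "sidon A X"
  shows "card X * (card X - 1) + 1 \<le> order A"
proof -
  interpret comm_group A by fact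
  have fX: "finite X" using assms finite_subset by blast
  let ?D = "SIGMA a:X. X - {a}"
  let ?d = "\<lambda>(a, b). a \<otimes>\<^bsub>A\<^esub> inv\<^bsub>A\<^esub> b"
  have "inj_on ?d ?D"
  proof (rule inj_onI)
    fix p q
    assume pq: "p \<in> ?D" "q \<in> ?D" "?d p = ?d q"
    obtain a b c d where p: "p = (a, b)" "q = (c, d)" by (cases p; cases q)
    with pq have h: "a \<in> X" "b \<in> X" "b \<noteq> a" "c \<in> X" "d \<in> X" "d \<noteq> c"
      "a \<otimes>\<^bsub>A\<^esub> inv\<^bsub>A\<^esub> b = c \<otimes>\<^bsub>A\<^esub> inv\<^bsub>A\<^esub> d"
      by auto
    then have m: "a \<in> carrier A" "b \<in> carrier A" "c \<in> carrier A" "d \<in> carrier A"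
      using assms(3) by auto
    have "a \<otimes>\<^bsub>A\<^esub> d = (a \<otimes>\<^bsub>A\<^esub> inv\<^bsub>A\<^esub> b) \<otimes>\<^bsub>A\<^esub> (b \<otimes>\<^bsub>A\<^esub> d)"
      using m by (simp add: m_assoc inv_solve_left)
    also have "\<dots> = (c \<otimes>\<^bsub>A\<^esub> inv\<^bsub>A\<^esub> d) \<otimes>\<^bsub>A\<^esub> (d \<otimes>\<^bsub>A\<^esub> b)"
      using m h(7) by (simp add: m_comm)
    also have "\<dots> = c \<otimes>\<^bsub>A\<^esub> b"
      using m by (simp add: m_assoc inv_solve_left')
    finally have e: "a \<otimes>\<^bsub>A\<^esub> d = c \<otimes>\<^bsub>A\<^esub> b" .
    \<comment> \<open>The other Sidon alternative, \<open>a = b\<close>, is excluded by membership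
      in \<open>?D\<close>.\<close>
    with assms(4) h have "a = c" by (auto simp: sidon_def)
    with e m p show "p = q" by simp
  qed
  moreover have "card ?D = card X * (card X - 1)"
    using fX by simp
  moreover have "?d ` ?D \<subseteq> carrier A - {\<one>\<^bsub>A\<^esub>}"
  proof -
    have "a \<otimes>\<^bsub>A\<^esub> inv\<^bsub>A\<^esub> b \<noteq> \<one>\<^bsub>A\<^esub>" if "a \<in> X" "b \<in> X" "b \<noteq> a" for a b
      using that assms(3) by (metis inv_equality inv_inv inv_closed subsetD)
    then show ?thesis using assms(3) by (auto simp: subset_iff)
  qed
  ultimately have "card X * (card X - 1) \<le> card (carrier A - {\<one>\<^bsub>A\<^esub>})"
    by (metis assms(2) card_image card_mono finite_Diff)
  moreover have "card (carrier A) > 0"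
    using assms(2) by (auto simp: card_gt_0_iff)
  ultimately show ?thesis by (simp add: order_def)
qed

text \<open>Equations map forward, and injectivity brings the resulting equality back. This reduces
  the Sidon check in the quotient by \<open>N_H\<close> to arithmetic in \<open>C_7\<close>.\<close>

lemma sidon_if_image_sidon:
  assumes "\<phi> \<in> hom A B" "inj_on \<phi> (carrier A)" "X \<subseteq> carrier A" "sidon B (\<phi> ` X)"
  shows "sidon A X"
  unfolding sidon_def
proof (intro ballI impI)
  fix a b c d assume h: "a \<in> X" "b \<in> X" "c \<in> X" "d \<in> X" "a \<otimes>\<^bsub>A\<^esub> c = b \<otimes>\<^bsub>A\<^esub> d"
  then have m: "a \<in> carrier A" "b \<in> carrier A" "c \<in> carrier A" "d \<in> carrier A"
    using assms(3) by auto
  have "\<phi> a \<otimes>\<^bsub>B\<^esub> \<phi> c = \<phi> b \<otimes>\<^bsub>B\<^esub> \<phi> d"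
    using m h(5) assms(1) by (metis hom_mult)
  then have "\<phi> a = \<phi> b \<or> \<phi> a = \<phi> d"
    using assms(4) h by (auto simp: sidon_def)
  then show "a = b \<or> a = d"
    using assms(2) m by (auto dest: inj_onD)
qed

section \<open>Arcs, degrees and short cycles of Cayley graphs\<close>

lemma verts_Cay [simp]: "verts (Cay G S) = carrier G"
  by (simp add: Cay_def)

lemma arcs_Cay: "arcs (Cay G S) = {(g, g \<otimes>\<^bsub>G\<^esub> s) | g s. g \<in> carrier G \<and> s \<in> S}"
  by (simp add: Cay_def)

lemma in_arcs_Cay: "(g, h) \<in> arcs (Cay G S) \<longleftrightarrow> g \<in> carrier G \<and> (\<exists>s\<in>S. h = g \<otimes>\<^bsub>G\<^esub> s)"
  by (auto simp: arcs_Cay)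

lemma Cay_tail_head [simp]: "tail (Cay G S) = fst" "head (Cay G S) = snd"
  by (simp_all add: Cay_def)

lemma arcs_ends_Cay [simp]: "arcs_ends (Cay G S) = arcs (Cay G S)"
  by (simp add: Cay_def)

lemma carrier_gen_dihedral: "carrier (gen_dihedral A) = carrier A \<times> {0, 1}"
  by (simp add: gen_dihedral_def)

lemma order_gen_dihedral: "order (gen_dihedral A) = 2 * order A"
  by (simp add: order_def carrier_gen_dihedral card_cartesian_product)

text \<open>The generators are involutions, so both arcs of an edge can be read from its end of
  parity 0, where no inverse occurs.\<close>

lemma arcs_Cay_gen_dihedral:
  assumes "comm_group A" "X \<subseteq> carrier A"
  shows "arcs (Cay (gen_dihedral A) (X \<times> {1})) =
    {((x, 0), (x \<otimes>\<^bsub>A\<^esub> s, 1)) | x s. x \<in> carrier A \<and> s \<in> X} \<union>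
    {((x \<otimes>\<^bsub>A\<^esub> s, 1), (x, 0)) | x s. x \<in> carrier A \<and> s \<in> X}" (is "?L = ?U \<union> ?V")
proof -
  interpret comm_group A by fact
  have "e \<in> ?L" if "e \<in> ?V" for e
  proof -
    from that obtain x s where e: "e = ((x \<otimes>\<^bsub>A\<^esub> s, 1), (x, 0))" "x \<in> carrier A" "s \<in> X"
      by auto
    \<comment> \<open>The generator \<open>(s, 1)\<close> is an involution, so applying it again
      leads back to \<open>x\<close>.\<close>
    then have "(x, 0) = (x \<otimes>\<^bsub>A\<^esub> s, 1) \<otimes>\<^bsub>gen_dihedral A\<^esub> (s, 1)"
      using assms(2) by (auto simp: gen_dihedral_def m_assoc)
    then show ?thesis
      using e assms(2) by (auto simp: arcs_Cay carrier_gen_dihedral)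
  qed
  moreover have "e \<in> ?L" if "e \<in> ?U" for e
    using that by (force simp: arcs_Cay gen_dihedral_def)
  moreover have "e \<in> ?U \<union> ?V" if "e \<in> ?L" for e
  proof -
    from that obtain x i s where e: "e = ((x, i), (x, i) \<otimes>\<^bsub>gen_dihedral A\<^esub> (s, 1))"
      "x \<in> carrier A" "i = 0 \<or> i = 1" "s \<in> X" "s \<in> carrier A"
      using assms(2) by (auto simp: arcs_Cay carrier_gen_dihedral)
    from e(3) show ?thesis
    proof
      assume "i = 0"
      then show ?thesis using e by (auto simp: gen_dihedral_def)
    next
      assume i: "i = 1"
      \<comment> \<open>At parity 1 the generator multiplies by the inverse of \<open>s\<close>,
        which gives the even end of the arc.\<close>
      have "x = (x \<otimes>\<^bsub>A\<^esub> inv\<^bsub>A\<^esub> s) \<otimes>\<^bsub>A\<^esub> s" using e by (simp add: m_assoc)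
      moreover have "x \<otimes>\<^bsub>A\<^esub> inv\<^bsub>A\<^esub> s \<in> carrier A" using e by simp
      moreover have "e = ((x, 1), (x \<otimes>\<^bsub>A\<^esub> inv\<^bsub>A\<^esub> s, 0))"
        using e(1) i by (simp add: gen_dihedral_def)
      ultimately show ?thesis using e(4) by blast
    qed
  qed
  ultimately show ?thesis by blast
qed

lemma bipartite_Cay_gen_dihedral:
  assumes "comm_group A" "X \<subseteq> carrier A"
  shows "bipartite (Cay (gen_dihedral A) (X \<times> {1}))"
proof -
  interpret comm_group A by fact
  show ?thesis
    unfolding bipartite_def arcs_ends_Cay arcs_Cay_gen_dihedral[OF assms] verts_Cay carrier_gen_dihedral
    using assms(2)
    by (intro exI[of _ "carrier A \<times> {0}"] exI[of _ "carrier A \<times> {1}"]) auto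
qed

lemma out_degree_Cay:
  assumes "group G" "S \<subseteq> carrier G" "g \<in> carrier G"
  shows "out_degree (Cay G S) g = card S"
proof -
  interpret group G by fact
  have "out_arcs (Cay G S) g = (\<lambda>s. (g, g \<otimes>\<^bsub>G\<^esub> s)) ` S"
    using assms(3) by (auto simp: out_arcs_def arcs_Cay)
  moreover have "inj_on (\<lambda>s. (g, g \<otimes>\<^bsub>G\<^esub> s)) S"
    using assms(2,3) by (auto simp: inj_on_def subset_iff)
  ultimately show ?thesis by (simp add: out_degree_def card_image)
qed

text \<open>Every arc changes side, so returning to the starting side takes an even number of
  arcs.\<close>

lemma bipartite_even_graph_cycle:
  assumes "bipartite \<Gamma>" "graph_cycle \<Gamma> p"
  shows "even (length p)"
proof -
  obtain U V where UV: "verts \<Gamma> = U \<union> V" "U \<inter> V = {}" "arcs_ends \<Gamma> \<subseteq> U \<times> V \<union> V \<times> U"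
    using assms(1) by (auto simp: bipartite_def)
  have flip: "tail \<Gamma> e \<in> U \<longleftrightarrow> head \<Gamma> e \<notin> U" if "e \<in> arcs \<Gamma>" for e
    using that UV(2,3) by (auto simp: arcs_ends_conv)
  \<comment> \<open>The induction needs open walks, because removing the first arc of a closed walk
    opens it.\<close>
  have "(u \<in> U \<longleftrightarrow> v \<in> U) \<longleftrightarrow> even (length q)"
    if "pre_digraph.cas \<Gamma> u q v" "set q \<subseteq> arcs \<Gamma>" for u q v
    using that
    by (induction q arbitrary: u) (use flip in \<open>auto simp: pre_digraph.cas.simps\<close>)
  then show ?thesis
    using assms(2) by (auto simp: graph_cycle_def pre_digraph.cycle_def pre_digraph.awalk_def)
qed

text \<open>A 4-cycle alternates between even vertices \<open>x\<close>, \<open>x'\<close> and odd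
  vertices \<open>y\<close>, \<open>y'\<close>, with \<open>y = x a = x' b\<close> and
  \<open>y' = x' c = x d\<close>. Hence \<open>a c = b d\<close>, where \<open>a \<noteq> b\<close>
  expresses \<open>x \<noteq> x'\<close> and \<open>a \<noteq> d\<close> expresses
  \<open>y \<noteq> y'\<close>.\<close>

lemma sidon_iff_no_4_cycle:
  assumes "comm_group A" "X \<subseteq> carrier A"
  shows "sidon A X \<longleftrightarrow>
    \<not> (\<exists>p. graph_cycle (Cay (gen_dihedral A) (X \<times> {1})) p \<and> length p = 4)"
    (is "_ \<longleftrightarrow> \<not> (\<exists>p. graph_cycle ?\<Gamma> p \<and> _)")
proof -
  interpret comm_group A by fact
  note arcs = arcs_Cay_gen_dihedral[OF assms]
  note walk_simps = graph_cycle_def pre_digraph.cycle_def pre_digraph.awalk_def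
    pre_digraph.cas.simps pre_digraph.awalk_verts.simps
  have "\<exists>p. graph_cycle ?\<Gamma> p \<and> length p = 4" if "\<not> sidon A X"
  proof -
    from that obtain a b c d where h: "a \<in> X" "b \<in> X" "c \<in> X" "d \<in> X"
      "a \<otimes>\<^bsub>A\<^esub> c = b \<otimes>\<^bsub>A\<^esub> d" "a \<noteq> b" "a \<noteq> d"
      by (auto simp: sidon_def)
    then have m: "a \<in> carrier A" "b \<in> carrier A" "c \<in> carrier A" "d \<in> carrier A"
      using assms(2) by auto
    \<comment> \<open>With one even vertex at the identity, \<open>a\<close> and \<open>d\<close>
      are the odd vertices. The other even vertex must satisfy \<open>?y b = a\<close>, and then
      \<open>?y c = d\<close> follows from the equation.\<close>
    let ?y = "a \<otimes>\<^bsub>A\<^esub> inv\<^bsub>A\<^esub> b"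
    have y: "?y \<in> carrier A" "?y \<otimes>\<^bsub>A\<^esub> b = a" using m by (simp_all add: m_assoc)
    have "?y \<otimes>\<^bsub>A\<^esub> c = (a \<otimes>\<^bsub>A\<^esub> c) \<otimes>\<^bsub>A\<^esub> inv\<^bsub>A\<^esub> b" using m by (simp add: m_ac)
    also have "\<dots> = (d \<otimes>\<^bsub>A\<^esub> b) \<otimes>\<^bsub>A\<^esub> inv\<^bsub>A\<^esub> b" using m h(5) by (simp add: m_comm)
    also have "\<dots> = d" using m by (simp add: m_assoc)
    finally have yc: "?y \<otimes>\<^bsub>A\<^esub> c = d" .
    have y1: "?y \<noteq> \<one>\<^bsub>A\<^esub>" using y h(6) m by auto
    have "((\<one>\<^bsub>A\<^esub>, 0), (a, 1)) \<in> arcs ?\<Gamma>" "((d, 1), (\<one>\<^bsub>A\<^esub>, 0)) \<in> arcs ?\<Gamma>"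
      unfolding arcs using h m by force+
    moreover have "((a, 1), (?y, 0)) \<in> arcs ?\<Gamma>" "((?y, 0), (d, 1)) \<in> arcs ?\<Gamma>"
      unfolding arcs using h y yc by (smt (verit) UnCI mem_Collect_eq)+
    ultimately have "graph_cycle ?\<Gamma>
        [((\<one>\<^bsub>A\<^esub>, 0), (a, 1)), ((a, 1), (?y, 0)), ((?y, 0), (d, 1)), ((d, 1), (\<one>\<^bsub>A\<^esub>, 0))]"
      using h(7) y1 y1[symmetric] by (simp add: walk_simps carrier_gen_dihedral)
    then show ?thesis by (intro exI conjI) auto
  qed
  moreover have "\<not> sidon A X" if "graph_cycle ?\<Gamma> p" "length p = 4" for p
  proof -
    have square: "\<not> sidon A X"
      if "((x, 0), (y, 1)) \<in> arcs ?\<Gamma>" "((y, 1), (x', 0)) \<in> arcs ?\<Gamma>"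
         "((x', 0), (y', 1)) \<in> arcs ?\<Gamma>" "((y', 1), (x, 0)) \<in> arcs ?\<Gamma>" "x \<noteq> x'" "y \<noteq> y'"
      for x x' y y'
    proof -
      from that obtain a b c d where h: "a \<in> X" "b \<in> X" "c \<in> X" "d \<in> X"
        "y = x \<otimes>\<^bsub>A\<^esub> a" "y = x' \<otimes>\<^bsub>A\<^esub> b" "y' = x' \<otimes>\<^bsub>A\<^esub> c" "y' = x \<otimes>\<^bsub>A\<^esub> d"
        and x: "x \<in> carrier A" "x' \<in> carrier A"
        unfolding arcs by auto
      have m: "a \<in> carrier A" "b \<in> carrier A" "c \<in> carrier A" "d \<in> carrier A"
        using assms(2) h by auto
      \<comment> \<open>Both groupings equal \<open>y\<close> times \<open>y'\<close>; commutativity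
        isolates the common factor \<open>x x'\<close>, which cancels.\<close>
      have "(x \<otimes>\<^bsub>A\<^esub> x') \<otimes>\<^bsub>A\<^esub> (a \<otimes>\<^bsub>A\<^esub> c) = (x \<otimes>\<^bsub>A\<^esub> a) \<otimes>\<^bsub>A\<^esub> (x' \<otimes>\<^bsub>A\<^esub> c)"
        using x m by (simp add: m_ac)
      also have "\<dots> = (x' \<otimes>\<^bsub>A\<^esub> b) \<otimes>\<^bsub>A\<^esub> (x \<otimes>\<^bsub>A\<^esub> d)"
        using h by simp
      also have "\<dots> = (x \<otimes>\<^bsub>A\<^esub> x') \<otimes>\<^bsub>A\<^esub> (b \<otimes>\<^bsub>A\<^esub> d)"
        using x m by (simp add: m_ac)
      finally have "a \<otimes>\<^bsub>A\<^esub> c = b \<otimes>\<^bsub>A\<^esub> d" using x m by simp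
      moreover have "a \<noteq> b" using h(5,6) that(5) x m by auto
      moreover have "a \<noteq> d" using h(5,8) that(6) by auto
      ultimately show ?thesis using h(1-4) unfolding sidon_def by blast
    qed
    from that(2) obtain e1 e2 e3 e4 where p: "p = [e1, e2, e3, e4]"
      by (auto simp: numeral_eq_Suc length_Suc_conv)
    with that(1) obtain v0 v1 v2 v3 where e: "e1 = (v0, v1)" "e2 = (v1, v2)" "e3 = (v2, v3)" "e4 = (v3, v0)"
      by (cases e1; cases e2; cases e3; cases e4) (auto simp: walk_simps)
    have in_arcs: "(v0, v1) \<in> arcs ?\<Gamma>" "(v1, v2) \<in> arcs ?\<Gamma>" "(v2, v3) \<in> arcs ?\<Gamma>" "(v3, v0) \<in> arcs ?\<Gamma>"
      and ne: "v0 \<noteq> v2" "v1 \<noteq> v3"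
      using that(1) p e by (auto simp: walk_simps)
    have alt: "(snd u = 0 \<and> snd v = 1) \<or> (snd u = 1 \<and> snd v = 0)" if "(u, v) \<in> arcs ?\<Gamma>" for u v
      using that unfolding arcs by auto
    from alt[OF in_arcs(1)] show ?thesis
    proof
      assume "snd v0 = 0 \<and> snd v1 = 1"
      with alt[OF in_arcs(2)] alt[OF in_arcs(3)]
      have "v0 = (fst v0, 0)" "v1 = (fst v1, 1)" "v2 = (fst v2, 0)" "v3 = (fst v3, 1)"
        by (auto simp: prod_eq_iff)
      then show ?thesis
        using square[of "fst v0" "fst v1" "fst v2" "fst v3"] in_arcs ne by metis
    next
      \<comment> \<open>The cycle starts at an odd vertex, so it is read from its second vertex
        on.\<close>
      assume "snd v0 = 1 \<and> snd v1 = 0"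
      with alt[OF in_arcs(2)] alt[OF in_arcs(3)]
      have "v0 = (fst v0, 1)" "v1 = (fst v1, 0)" "v2 = (fst v2, 1)" "v3 = (fst v3, 0)"
        by (auto simp: prod_eq_iff)
      then show ?thesis
        using square[of "fst v1" "fst v2" "fst v3" "fst v0"] in_arcs ne by metis
    qed
  qed
  ultimately show ?thesis by blast
qed

text \<open>Length 2 is excluded by the definition of a cycle, odd lengths by bipartiteness, and 4
  by the Sidon property.\<close>

lemma sidon_graph_cycle_length:
  assumes "comm_group A" "X \<subseteq> carrier A" "sidon A X"
    and "graph_cycle (Cay (gen_dihedral A) (X \<times> {1})) p"
  shows "6 \<le> length p"
proof -
  have "even (length p)" "length p \<noteq> 4" "3 \<le> length p"
    using bipartite_even_graph_cycle[OF bipartite_Cay_gen_dihedral[OF assms(1,2)] assms(4)]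
      sidon_iff_no_4_cycle[OF assms(1,2)] assms(3,4)
    by (auto simp: graph_cycle_def)
  then show ?thesis by presburger
qed


section \<open>Isomorphisms and connectedness\<close>

text \<open>When arcs are pairs of vertices, the vertex map determines the arc map. As the arc set
  of \<open>H\<close> is exactly the image, the inverse direction needs no separate check.\<close>

lemma digraph_iso_with_projI:
  assumes "pair_wf_digraph G" "bij_betw f (pverts G) (pverts H)"
    and "parcs H = map_prod f f ` parcs G"
  shows "digraph_iso (with_proj G) (with_proj H)"
proof -
  interpret pair_wf_digraph G by fact
  let ?h = "\<lparr>iso_verts = f, iso_arcs = map_prod f f, iso_head = snd, iso_tail = fst\<rparr>"
  have inj: "inj_on f (pverts G)" using assms(2) by (simp add: bij_betw_def)
  have "parcs G \<subseteq> pverts G \<times> pverts G"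
    using wellformed' by auto
  then have "inj_on (map_prod f f) (parcs G)"
    using map_prod_inj_on[OF inj inj] by (rule inj_on_subset[rotated])
  then have "pre_digraph.digraph_isomorphism (with_proj G) ?h"
    using inj assms(1) by (simp add: pre_digraph.digraph_isomorphism_def wf_digraph_wp_iff)
  moreover have "with_proj H = app_iso ?h (with_proj G)"
    using assms(2,3) by (simp add: app_iso_def with_proj_def bij_betw_def)
  ultimately show ?thesis unfolding digraph_iso_def by blast
qed

lemma pair_wf_digraph_Cay:
  assumes "group G" "S \<subseteq> carrier G"
  shows "pair_wf_digraph
    \<lparr>pverts = carrier G, parcs = {(g, g \<otimes>\<^bsub>G\<^esub> s) | g s. g \<in> carrier G \<and> s \<in> S}\<rparr>"
proof -
  interpret group G by fact
  show ?thesis using assms(2) by unfold_locales auto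
qed

lemma digraph_iso_Cay:
  assumes "group G" "S \<subseteq> carrier G" "\<phi> \<in> iso G H"
  shows "digraph_iso (Cay G S) (Cay H (\<phi> ` S))"
  unfolding Cay_def
proof (rule digraph_iso_with_projI[OF pair_wf_digraph_Cay[OF assms(1,2)]])
  have im: "\<phi> ` carrier G = carrier H" and hom: "\<phi> \<in> hom G H"
    using assms(3) by (auto simp: iso_def bij_betw_def)
  have mult: "\<phi> (g \<otimes>\<^bsub>G\<^esub> s) = \<phi> g \<otimes>\<^bsub>H\<^esub> \<phi> s" if "g \<in> carrier G" "s \<in> S" for g s
    using that hom assms(2) by (auto simp: hom_mult subset_iff)
  show "parcs \<lparr>pverts = carrier H, parcs = {(g, g \<otimes>\<^bsub>H\<^esub> s) | g s. g \<in> carrier H \<and> s \<in> \<phi> ` S}\<rparr> =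
    map_prod \<phi> \<phi> ` parcs \<lparr>pverts = carrier G, parcs = {(g, g \<otimes>\<^bsub>G\<^esub> s) | g s. g \<in> carrier G \<and> s \<in> S}\<rparr>"
    (is "?L = ?R")
  proof
    show "?R \<subseteq> ?L" using im mult by fastforce
    show "?L \<subseteq> ?R"
    proof
      fix e assume "e \<in> ?L"
      then obtain h s where "h \<in> \<phi> ` carrier G" "s \<in> S" "e = (h, h \<otimes>\<^bsub>H\<^esub> \<phi> s)"
        using im by auto
      then obtain g where "g \<in> carrier G" "s \<in> S" "e = (\<phi> g, \<phi> g \<otimes>\<^bsub>H\<^esub> \<phi> s)"
        by auto
      then show "e \<in> ?R"
        using mult by (intro image_eqI[of _ _ "(g, g \<otimes>\<^bsub>G\<^esub> s)"]) auto
    qed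
  qed
qed (use assms(3) in \<open>simp add: iso_def\<close>)

lemma gen_dihedral_iso:
  assumes "group A" "group B" "\<phi> \<in> iso A B"
  shows "map_prod \<phi> id \<in> iso (gen_dihedral A) (gen_dihedral B)"
proof -
  interpret group_hom A B \<phi>
    using assms by (simp add: group_hom_def group_hom_axioms_def iso_def)
  have "map_prod \<phi> id \<in> hom (gen_dihedral A) (gen_dihedral B)"
    by (rule homI) (auto simp: gen_dihedral_def)
  moreover have "bij_betw (map_prod \<phi> id) (carrier (gen_dihedral A)) (carrier (gen_dihedral B))"
    using assms(3) unfolding carrier_gen_dihedral
    by (intro bij_betw_map_prod) (auto simp: iso_def)
  ultimately show ?thesis by (simp add: iso_def)
qed

text \<open>Reachability in the symmetric closure is symmetric, so any two vertices are joined
  through \<open>r\<close>.\<close>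

lemma connectedI_root:
  assumes "r \<in> verts \<Gamma>"
    and "\<And>u. u \<in> verts \<Gamma> \<Longrightarrow> (r, u) \<in> rtrancl_on (verts \<Gamma>) ((arcs_ends \<Gamma>)\<^sup>s)"
  shows "connected \<Gamma>"
proof -
  have "sym ((arcs_ends \<Gamma>)\<^sup>s)" by (auto simp: symcl_def sym_def)
  then have "sym (rtrancl_on (verts \<Gamma>) ((arcs_ends \<Gamma>)\<^sup>s))" by (rule rtrancl_on_sym)
  then show ?thesis
    unfolding connected_conv using assms by (blast dest: symD intro: rtrancl_on_trans)
qed


section \<open>Separation\<close>

text \<open>The separating map is an injection into the words of length \<open>length Y\<close> over
  \<open>q\<close> letters.\<close>

lemma order_le_power_separating:
  assumes "group G" "finite (carrier G)" "pattern G Y" "f ` carrier G \<subseteq> {..<q}" "separating G f Y"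
  shows "order G \<le> q ^ length Y"
proof -
  interpret group G by fact
  have "(\<lambda>g. map (\<lambda>y. f (g \<otimes>\<^bsub>G\<^esub> y)) Y) ` carrier G \<subseteq>
      {xs. set xs \<subseteq> {..<q} \<and> length xs = length Y}"
    using assms(3,4) by (auto simp: pattern_def image_subset_iff subset_iff)
  then have "order G \<le> card {xs. set xs \<subseteq> {..<q} \<and> length xs = length Y}"
    unfolding order_def using assms(5)
    by (intro card_inj_on_le) (auto simp: separating_def finite_lists_length_eq)
  then show ?thesis by (simp add: card_lists_length_eq)
qed


section \<open>The Heawood graph\<close>

lemma carrier_C7: "carrier (integer_mod_group 7) = {0, 1, 2, 3, 4, 5, 6}"
  by (auto simp: carrier_integer_mod_group)

lemma S_H_elements: "S_H = {(1, 1), (4, 1), (3, 1)}"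
  by (simp add: S_H_def honeycomb_gens_def)

lemma S_H_eq: "S_H = {1, 4, 3} \<times> {1}"
  by (auto simp: S_H_elements)

text \<open>The differences \<open>4 - 3\<close>, \<open>3 - 1\<close>, \<open>4 - 1\<close> are 1,
  2, 3 and their negatives 6, 5, 4, so each nonzero residue arises exactly once.\<close>

lemma sidon_C7: "sidon (integer_mod_group 7) {1, 4, 3}"
  by (simp add: sidon_def)

lemma arcs_Cay_G_H:
  "arcs (Cay G_H S_H) =
    {((x, 0), ((x + s) mod 7, 1)) | x s. x \<in> {0..<7} \<and> s \<in> {1, 4, 3}} \<union>
    {(((x + s) mod 7, 1), (x, 0)) | x s. x \<in> {0..<7} \<and> s \<in> {1, 4, 3}}"
  using arcs_Cay_gen_dihedral[of "integer_mod_group 7" "{1, 4, 3}"]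
  by (simp add: G_H_def S_H_eq carrier_integer_mod_group)

lemma order_G_H: "order G_H = 14"
  by (simp add: G_H_def order_gen_dihedral) (simp add: order_def carrier_integer_mod_group)

lemma group_G_H: "group G_H"
  by (simp add: G_H_def group_gen_dihedral)

lemma carrier_G_H: "carrier G_H = {0, 1, 2, 3, 4, 5, 6} \<times> {0, 1}"
  by (simp add: G_H_def carrier_gen_dihedral carrier_C7)

lemma S_H_subset: "S_H \<subseteq> carrier G_H"
  by (auto simp: S_H_eq carrier_G_H)

text \<open>The powers \<open>t^x\<close> in the field with 8 elements, where \<open>t^3 = t + 1\<close>, written in the
  basis \<open>t^2, t, 1\<close>. Multiplying \<open>t^3 + t + 1 = 0\<close> by powers of \<open>t\<close> shows that
  the translates of \<open>{0, 1, 3}\<close> are the lines.\<close>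

definition singer_point :: "int \<Rightarrow> bit \<times> bit \<times> bit" where
  "singer_point x = (if x = 0 then (0, 0, 1) else if x = 1 then (0, 1, 0)
     else if x = 2 then (1, 0, 0) else if x = 3 then (0, 1, 1) else if x = 4 then (1, 1, 0)
     else if x = 5 then (1, 1, 1) else (1, 0, 1))"

text \<open>The indices are the \<open>x\<close> with \<open>y = x + s\<close>, to match the arcs of
  the Cayley graph. Since \<open>-{1, 4, 3} = {0, 1, 3} - 4\<close> modulo 7, they form the
  translate of \<open>{0, 1, 3}\<close> by \<open>y - 4\<close>.\<close>

definition singer_line :: "int \<Rightarrow> (bit \<times> bit \<times> bit) set" where
  "singer_line y = singer_point ` (\<lambda>s. (y - s) mod 7) ` {1, 4, 3}"

lemma inj_on_singer_point: "inj_on singer_point {0, 1, 2, 3, 4, 5, 6}"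
  by (simp add: singer_point_def)

lemma fano_points_eq: "fano_points = singer_point ` {0, 1, 2, 3, 4, 5, 6}"
proof -
  have "(a, b, c) \<in> fano_points \<longleftrightarrow> (a, b, c) \<in> singer_point ` {0, 1, 2, 3, 4, 5, 6}" for a b c
    unfolding fano_points_def
    by (cases a; cases b; cases c) (simp_all add: singer_point_def zero_prod_def)
  then show ?thesis by auto
qed

text \<open>The three points of a line sum to zero, so in characteristic 2 any two of them sum to
  the third.\<close>

lemma singer_line_eq:
  assumes "z \<in> {0, 1, 2, 3, 4, 5, 6}" "p \<in> singer_line z" "q \<in> singer_line z" "p \<noteq> q"
  shows "singer_line z = {p, q, p + q}"
proof -
  have char2: "x + (x + y) = y" for x y :: "bit \<times> bit \<times> bit"
    by (simp add: add.assoc[symmetric] prod_eq_iff)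
  let ?a = "singer_point ((z - 1) mod 7)" and ?b = "singer_point ((z - 4) mod 7)"
  \<comment> \<open>This is \<open>t^3 = t + 1\<close> multiplied by \<open>t^(z - 4)\<close>, with
    its terms rearranged in characteristic 2.\<close>
  have "singer_point ((z - 3) mod 7) = ?a + ?b"
    using assms(1) by (elim insertE emptyE) (simp_all add: singer_point_def)
  then have line: "singer_line z = {?a, ?b, ?a + ?b}"
    by (simp add: singer_line_def)
  have "?b + (?a + ?b) = ?a"
    using char2[of ?b ?a] by (simp add: add.commute)
  then show ?thesis
    using assms(2-4) char2[of ?a ?b] unfolding line by (auto simp: add.commute)
qed

lemma mod_7_mem: "(x :: int) mod 7 \<in> {0, 1, 2, 3, 4, 5, 6}"
  using pos_mod_bound[of 7 x] pos_mod_sign[of 7 x] by (simp; linarith)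

lemma fano_lines_eq: "fano_lines = singer_line ` {0, 1, 2, 3, 4, 5, 6}"
proof (intro equalityI subsetI)
  fix l assume "l \<in> fano_lines"
  then obtain i j :: int where ij: "i \<in> {0, 1, 2, 3, 4, 5, 6}" "j \<in> {0, 1, 2, 3, 4, 5, 6}"
    "singer_point i \<noteq> singer_point j"
    and l: "l = {singer_point i, singer_point j, singer_point i + singer_point j}"
    unfolding fano_lines_def fano_points_eq by blast
  have "i \<noteq> j" using ij(3) by auto
  \<comment> \<open>The nonzero residue \<open>i - j\<close> is a difference of two elements of
    \<open>{1, 4, 3}\<close>, so one of the index sets contains both \<open>i\<close> and
    \<open>j\<close>.\<close>
  then have "\<exists>z\<in>{0, 1, 2, 3, 4, 5, 6}. {i, j} \<subseteq> (\<lambda>s. (z - s) mod 7) ` {1, 4, 3}"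
    using ij(1,2) by (elim insertE emptyE) simp_all
  then obtain z where z: "z \<in> {0, 1, 2, 3, 4, 5, 6}" "{i, j} \<subseteq> (\<lambda>s. (z - s) mod 7) ` {1, 4, 3}"
    by (rule bexE)
  have "singer_point ` {i, j} \<subseteq> singer_line z"
    unfolding singer_line_def using z(2) by (rule image_mono)
  then have "l = singer_line z"
    using singer_line_eq[OF z(1) _ _ ij(3)] l by simp
  then show "l \<in> singer_line ` {0, 1, 2, 3, 4, 5, 6}"
    using z(1) by (rule image_eqI)
next
  fix l assume "l \<in> singer_line ` {0, 1, 2, 3, 4, 5, 6}"
  then obtain z where z: "z \<in> {0, 1, 2, 3, 4, 5, 6}" "l = singer_line z" by blast
  let ?p = "singer_point ((z - 1) mod 7)" and ?q = "singer_point ((z - 4) mod 7)"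
  have "?p \<noteq> ?q"
    using z(1) by (elim insertE emptyE) (simp_all add: singer_point_def)
  moreover have "?p \<in> fano_points" "?q \<in> fano_points"
    unfolding fano_points_eq by (rule imageI, rule mod_7_mem)+
  moreover have "l = {?p, ?q, ?p + ?q}"
    using singer_line_eq[OF z(1)] \<open>?p \<noteq> ?q\<close> z(2) by (simp add: singer_line_def)
  ultimately show "l \<in> fano_lines" unfolding fano_lines_def by blast
qed

lemma inj_on_singer_line: "inj_on singer_line {0, 1, 2, 3, 4, 5, 6}"
proof (rule inj_onI)
  fix y z :: int
  assume yz: "y \<in> {0, 1, 2, 3, 4, 5, 6}" "z \<in> {0, 1, 2, 3, 4, 5, 6}" "singer_line y = singer_line z"
  have "(\<lambda>s. (u - s) mod 7) ` {1, 4, 3} \<subseteq> {0, 1, 2, 3, 4, 5, 6}" for u :: int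
    by (rule image_subsetI, rule mod_7_mem)
  then have "(\<lambda>s. (y - s) mod 7) ` {1, 4, 3} = (\<lambda>s. (z - s) mod 7) ` {1, 4, 3}"
    using yz(3) unfolding singer_line_def by (simp only: inj_on_image_eq_iff[OF inj_on_singer_point])
  \<comment> \<open>Distinct translates of a perfect difference set of this kind share only one
    residue, so a single inclusion already forces \<open>y = z\<close>.\<close>
  then have "(\<lambda>s. (y - s) mod 7) ` {1, 4, 3} \<subseteq> (\<lambda>s. (z - s) mod 7) ` {1, 4, 3}"
    by simp
  then show "y = z"
    using yz(1,2) by (elim insertE emptyE) simp_all
qed

lemma singer_incidence:
  assumes "x \<in> {0..<7}" "y \<in> {0..<7}"
  shows "singer_point x \<in> singer_line y \<longleftrightarrow> (\<exists>s\<in>{1, 4, 3}. y = (x + s) mod 7)"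
proof -
  have eq: "{0, 1, 2, 3, 4, 5, 6} = {0..<7 :: int}" by auto
  have "singer_point x \<in> singer_line y \<longleftrightarrow> (\<exists>s\<in>{1, 4, 3}. singer_point x = singer_point ((y - s) mod 7))"
    by (auto simp: singer_line_def)
  also have "\<dots> \<longleftrightarrow> (\<exists>s\<in>{1, 4, 3}. x = (y - s) mod 7)"
    using inj_on_singer_point assms(1) unfolding eq by (intro bex_cong refl) (auto dest: inj_onD)
  also have "\<dots> \<longleftrightarrow> (\<exists>s\<in>{1, 4, 3}. y = (x + s) mod 7)"
    using assms by (intro bex_cong refl iffI) (simp_all add: mod_simps)
  finally show ?thesis .
qed

lemma swap_image_Collect:
  "prod.swap ` {(f x y, g x y) | x y. P x y} = {(g x y, f x y) | x y. P x y}"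
  by force

text \<open>Even vertices become points and odd vertices become lines;
  \<open>singer_incidence\<close> matches adjacency with incidence.\<close>

lemma digraph_iso_heawood: "digraph_iso (Cay G_H S_H) heawood_graph"
proof -
  let ?E = "{(g, g \<otimes>\<^bsub>G_H\<^esub> s) | g s. g \<in> carrier G_H \<and> s \<in> S_H}"
  define F where "F = (\<lambda>(x, e :: int). if e = 0 then Inl (singer_point x) else Inr (singer_line x))"
  have Z: "{0, 1, 2, 3, 4, 5, 6} = {0..<7 :: int}" by auto
  note points = fano_points_eq[unfolded Z] and lines = fano_lines_eq[unfolded Z]
  have car: "carrier G_H = {0..<7} \<times> {0, 1}"
    using carrier_G_H unfolding Z .
  have E: "?E = {((x, 0), ((x + s) mod 7, 1)) | x s. x \<in> {0..<7} \<and> s \<in> {1, 4, 3}} \<union>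
      {(((x + s) mod 7, 1), (x, 0)) | x s. x \<in> {0..<7} \<and> s \<in> {1, 4, 3}}"
    using arcs_Cay_G_H by (simp only: arcs_Cay)
  have "inj_on F (carrier G_H)"
    unfolding car F_def
    by (rule inj_onI) (auto split: if_splits simp: inj_on_eq_iff[OF inj_on_singer_point[unfolded Z]]
        inj_on_eq_iff[OF inj_on_singer_line[unfolded Z]])
  moreover have "F ` carrier G_H = Inl ` fano_points \<union> Inr ` fano_lines"
  proof -
    have "carrier G_H = (\<lambda>x. (x, 0)) ` {0..<7} \<union> (\<lambda>x. (x, 1)) ` {0..<7}"
      unfolding car by auto
    then show ?thesis
      unfolding points lines by (simp add: image_Un image_image F_def)
  qed
  ultimately have bij: "bij_betw F (carrier G_H) (Inl ` fano_points \<union> Inr ` fano_lines)"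
    by (simp add: bij_betw_def)
  have up: "{(Inl p, Inr l) | p l. p \<in> fano_points \<and> l \<in> fano_lines \<and> p \<in> l} =
     map_prod F F ` {((x, 0), ((x + s) mod 7, 1)) | x s. x \<in> {0..<7} \<and> s \<in> {1, 4, 3}}"
    (is "?L = ?R")
  proof
    show "?L \<subseteq> ?R"
    proof clarify
      fix p l assume "p \<in> fano_points" "l \<in> fano_lines" "p \<in> l"
      then obtain x y where xy: "x \<in> {0..<7}" "y \<in> {0..<7}" "p = singer_point x" "l = singer_line y"
        unfolding points lines by blast
      with \<open>p \<in> l\<close> singer_incidence obtain s where "s \<in> {1, 4, 3}" "y = (x + s) mod 7"
        by auto
      then show "(Inl p, Inr l) \<in> ?R"
        using xy by (intro image_eqI[of _ _ "((x, 0), ((x + s) mod 7, 1))"]) (auto simp: F_def)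
    qed
    show "?R \<subseteq> ?L"
    proof (rule subsetI, elim imageE CollectE exE conjE)
      fix e a x s
      assume e: "e = map_prod F F a" "a = ((x, 0), ((x + s) mod 7, 1))"
        and xs: "x \<in> {0..<7}" "s \<in> {1, 4, 3}"
      have y: "(x + s) mod 7 \<in> {0..<7}" by simp
      have "singer_point x \<in> singer_line ((x + s) mod 7)"
        unfolding singer_incidence[OF xs(1) y] by (intro bexI[of _ s] refl xs(2))
      moreover have "singer_point x \<in> fano_points" "singer_line ((x + s) mod 7) \<in> fano_lines"
        unfolding points lines by (rule imageI[OF xs(1)], rule imageI[OF y])
      moreover have "e = (Inl (singer_point x), Inr (singer_line ((x + s) mod 7)))"
        by (simp add: e F_def)
      ultimately show "e \<in> ?L" by blast
    qed
  qed
  \<comment> \<open>The line-to-point arcs follow from \<open>up\<close>, because swapping the ends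
    commutes with \<open>map_prod F F\<close>.\<close>
  have down: "{(Inr l, Inl p) | p l. p \<in> fano_points \<and> l \<in> fano_lines \<and> p \<in> l} =
     map_prod F F ` {(((x + s) mod 7, 1), (x, 0)) | x s. x \<in> {0..<7} \<and> s \<in> {1, 4, 3}}"
  proof -
    have "{(Inr l, Inl p) | p l. p \<in> fano_points \<and> l \<in> fano_lines \<and> p \<in> l} =
      prod.swap ` {(Inl p, Inr l) | p l. p \<in> fano_points \<and> l \<in> fano_lines \<and> p \<in> l}"
      by (rule swap_image_Collect[symmetric])
    also have "\<dots> = map_prod F F ` prod.swap ` {((x, 0), ((x + s) mod 7, 1)) | x s. x \<in> {0..<7} \<and> s \<in> {1, 4, 3}}"
      unfolding up image_image by (rule image_cong[OF refl]) (simp add: prod_eq_iff)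
    also have "prod.swap ` {((x, 0), ((x + s) mod 7, 1)) | x s. x \<in> {0..<7} \<and> s \<in> {1, 4, 3}} =
      {(((x + s) mod 7, 1), (x, 0)) | x s. x \<in> {0..<7} \<and> s \<in> {1, 4, 3}}"
      by (rule swap_image_Collect)
    finally show ?thesis .
  qed
  show ?thesis
    unfolding Cay_def heawood_graph_def levi_graph_def
  proof (rule digraph_iso_with_projI[OF pair_wf_digraph_Cay[OF group_G_H S_H_subset]])
  qed (use bij in \<open>simp_all only: pair_pre_digraph.simps E up down image_Un\<close>)
qed

section \<open>Connectedness and girth of the graph on 14 vertices\<close>

lemma connected_Cay_G_H: "connected (Cay G_H S_H)"
proof (rule connectedI_root[of "(0, 0)"])
  let ?R = "rtrancl_on (carrier G_H) ((arcs (Cay G_H S_H))\<^sup>s)"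
  have car: "(x mod 7, e) \<in> carrier G_H" if "e = 0 \<or> e = 1" for x e
    using that by (auto simp: G_H_def carrier_gen_dihedral carrier_integer_mod_group)
  have up: "((0, 0), ((x + s) mod 7, 1)) \<in> ?R"
    if "((0, 0), (x mod 7, 0)) \<in> ?R" "s \<in> {1, 4, 3}" for x s
  proof (rule rtrancl_on_into_rtrancl_on[OF that(1)])
    have "((x mod 7, 0), ((x mod 7 + s) mod 7, 1)) \<in> arcs (Cay G_H S_H)"
      unfolding arcs_Cay_G_H using that(2) pos_mod_bound[of 7 x] pos_mod_sign[of 7 x]
      by (intro UnI1 CollectI exI[of _ "x mod 7"] exI[of _ s]) auto
    then show "((x mod 7, 0), ((x + s) mod 7, 1)) \<in> (arcs (Cay G_H S_H))\<^sup>s"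
      by (simp add: symcl_def mod_simps)
  qed (use car in auto)
  \<comment> \<open>Since \<open>4 - 3 = 1\<close>, the path \<open>(x, 0)\<close>,
    \<open>(x + 4, 1)\<close>, \<open>(x + 1, 0)\<close> advances an even vertex by 1. Iterating it
    reaches all even vertices.\<close>
  have step: "((0, 0), ((x + 1) mod 7, 0)) \<in> ?R" if "((0, 0), (x mod 7, 0)) \<in> ?R" for x
  proof (rule rtrancl_on_into_rtrancl_on[OF up[OF that, of 4]])
    have "((((x + 1) mod 7 + 3) mod 7, 1), ((x + 1) mod 7, 0)) \<in> arcs (Cay G_H S_H)"
      unfolding arcs_Cay_G_H using pos_mod_bound[of 7 "x + 1"] pos_mod_sign[of 7 "x + 1"]
      by (intro UnI2 CollectI exI[of _ "(x + 1) mod 7"] exI[of _ 3]) auto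
    moreover have "((x + 1) mod 7 + 3) mod 7 = (x + 4) mod 7"
      by presburger
    ultimately show "(((x + 4) mod 7, 1), ((x + 1) mod 7, 0)) \<in> (arcs (Cay G_H S_H))\<^sup>s"
      by (simp add: symcl_def)
  qed (use car in auto)
  have even: "((0, 0), (int n mod 7, 0)) \<in> ?R" for n
  proof (induction n)
    case 0
    show ?case using car[of 0 0] by auto
  next
    case (Suc n)
    then show ?case using step[of "int n"] by (simp add: add.commute)
  qed
  show "((0, 0), u) \<in> rtrancl_on (verts (Cay G_H S_H)) ((arcs_ends (Cay G_H S_H))\<^sup>s)"
    if "u \<in> verts (Cay G_H S_H)" for u
  proof -
    from that obtain x e where u: "u = (x, e)" "0 \<le> x" "x < 7" "e = 0 \<or> e = 1"
      by (auto simp: G_H_def carrier_gen_dihedral carrier_integer_mod_group)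
    show ?thesis
    proof (cases "e = 0")
      case True
      then show ?thesis using even[of "nat x"] u by simp
    next
      case False
      \<comment> \<open>An odd vertex \<open>(x, 1)\<close> is reached by generator 1 from the even
        vertex at \<open>x - 1\<close>. The representative \<open>x + 6\<close> avoids truncation by
        \<open>nat\<close> at \<open>x = 0\<close>.\<close>
      have "((0, 0), ((int (nat (x + 6)) + 1) mod 7, 1)) \<in> ?R"
        by (rule up[OF even]) simp
      then show ?thesis using u False by (simp add: add.assoc)
    qed
  qed
qed (simp add: carrier_G_H)

lemma girth_Cay_G_H: "girth (Cay G_H S_H) = 6"
proof -
  let ?\<Gamma> = "Cay G_H S_H"
  \<comment> \<open>A hexagonal face at the identity: the generators 1, 4, 3, 1, 4, 3 in turn,
    closing up because \<open>1 - 4 + 3 - 1 + 4 - 3 = 0\<close>. Zipping with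
    \<open>rotate1 ?v\<close> pairs each vertex with its successor.\<close>
  let ?v = "[(0, 0), (1, 1), (4, 0), (0, 1), (6, 0), (3, 1)] :: (int \<times> int) list"
  let ?p = "zip ?v (rotate1 ?v)"
  have "set ?p \<subseteq> arcs ?\<Gamma>"
    by (simp add: in_arcs_Cay G_H_def gen_dihedral_def S_H_elements carrier_C7)
  then have "graph_cycle ?\<Gamma> ?p"
    by (simp add: graph_cycle_def pre_digraph.cycle_def pre_digraph.awalk_def
      pre_digraph.cas.simps pre_digraph.awalk_verts.simps carrier_G_H)
  then have "enat 6 \<in> {enat (length p) | p. graph_cycle ?\<Gamma> p}"
    by force
  moreover have "6 \<le> length p" if "graph_cycle ?\<Gamma> p" for p
    using sidon_graph_cycle_length[OF _ _ sidon_C7] that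
    by (auto simp: G_H_def S_H_eq carrier_C7)
  ultimately have "girth ?\<Gamma> = enat 6"
    unfolding girth_def by (intro cInf_eq_minimum) auto
  then show ?thesis by (simp add: numeral_eq_enat)
qed


section \<open>Honeycomb quotients\<close>

lemma comm_group_Z_squared: "comm_group Z_squared"
  unfolding Z_squared_def by (rule group.group_comm_groupI)
    (auto simp: DirProd_group)

lemma comm_group_honeycomb:
  assumes "subgroup N Z_squared"
  shows "comm_group (Z_squared Mod N)"
  using comm_group.abelian_FactGroup[OF comm_group_Z_squared assms] .

lemma coset_in_quotient:
  assumes "subgroup N Z_squared"
  shows "N #>\<^bsub>Z_squared\<^esub> v \<in> carrier (Z_squared Mod N)"
  by (cases v) (auto simp: FactGroup_def RCOSETS_def Z_squared_def)

lemma honeycomb_gens_in_quotient: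
  assumes "subgroup N Z_squared"
  shows "{N #>\<^bsub>Z_squared\<^esub> u,
    (N #>\<^bsub>Z_squared\<^esub> u) \<otimes>\<^bsub>Z_squared Mod N\<^esub> (N #>\<^bsub>Z_squared\<^esub> v), N #>\<^bsub>Z_squared\<^esub> v}
    \<subseteq> carrier (Z_squared Mod N)"
proof -
  interpret comm_group "Z_squared Mod N" by (rule comm_group_honeycomb[OF assms])
  show ?thesis
    using coset_in_quotient[OF assms] m_closed[OF coset_in_quotient[OF assms] coset_in_quotient[OF assms]]
    by blast
qed

text \<open>Reduces nondegeneracy to arithmetic in the quotient: all generators have parity 1, so
  their number is that of their first components, and \<open>sidon_iff_no_4_cycle\<close> handles
  the faces.\<close>

lemma nondegenerate_iff_sidon:
  assumes "subgroup N Z_squared"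
  defines "A \<equiv> Z_squared Mod N" and "v1 \<equiv> N #>\<^bsub>Z_squared\<^esub> (1, 0)" and "v2 \<equiv> N #>\<^bsub>Z_squared\<^esub> (0, 1)"
  shows "nondegenerate N \<longleftrightarrow>
    card {v1, v1 \<otimes>\<^bsub>A\<^esub> v2, v2} = 3 \<and> sidon A {v1, v1 \<otimes>\<^bsub>A\<^esub> v2, v2}"
proof -
  let ?X = "{v1, v1 \<otimes>\<^bsub>A\<^esub> v2, v2}"
  interpret A: comm_group A unfolding A_def by (rule comm_group_honeycomb[OF assms(1)])
  have X: "?X \<subseteq> carrier A"
    unfolding v1_def v2_def A_def by (rule honeycomb_gens_in_quotient[OF assms(1)])
  have S: "honeycomb_S N = ?X \<times> {1}"
    unfolding honeycomb_S_def honeycomb_gens_def v1_def v2_def A_def by auto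
  have card: "card (?X \<times> {1 :: int}) = card ?X"
    by (simp only: card_cartesian_product) simp
  show ?thesis
    unfolding nondegenerate_def honeycomb_quotient_def honeycomb_group_def S A_def[symmetric] card
      sidon_iff_no_4_cycle[OF A.comm_group_axioms X]
    by (rule refl)
qed

text \<open>Three Sidon elements force at least \<open>3 * 2 + 1 = 7\<close> cosets, and the
  dihedral extension doubles the order.\<close>

lemma nondegenerate_order_ge_14:
  assumes "finite_index_sublattice N" "nondegenerate N"
  shows "14 \<le> order (honeycomb_group N)"
proof -
  have N: "subgroup N Z_squared" and fin: "finite (carrier (Z_squared Mod N))"
    using assms(1) by (auto simp: finite_index_sublattice_def FactGroup_def)
  interpret A: comm_group "Z_squared Mod N" by (rule comm_group_honeycomb[OF N])
  let ?v1 = "N #>\<^bsub>Z_squared\<^esub> (1, 0)" and ?v2 = "N #>\<^bsub>Z_squared\<^esub> (0, 1)"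
  let ?X = "{?v1, ?v1 \<otimes>\<^bsub>Z_squared Mod N\<^esub> ?v2, ?v2}"
  have "card ?X = 3" "sidon (Z_squared Mod N) ?X"
    using assms(2) nondegenerate_iff_sidon[OF N] by blast+
  moreover have "?X \<subseteq> carrier (Z_squared Mod N)"
    by (rule honeycomb_gens_in_quotient[OF N])
  ultimately have "7 \<le> order (Z_squared Mod N)"
    using card_sidon_le_order[OF A.comm_group_axioms fin, of ?X] by simp
  then show ?thesis by (simp add: honeycomb_group_def order_gen_dihedral)
qed

section \<open>The sublattice of index 7\<close>

lemma N_H_iso:
  defines "\<psi> \<equiv> \<lambda>X. the_elem ((\<lambda>(x, y). (x + 3 * y) mod 7) ` X) :: int"
  shows "subgroup N_H Z_squared"
    and "\<psi> \<in> iso (Z_squared Mod N_H) (integer_mod_group 7)"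
    and "\<psi> (N_H #>\<^bsub>Z_squared\<^esub> (x, y)) = (x + 3 * y) mod 7"
proof -
  let ?h = "\<lambda>(x, y). (x + 3 * y) mod 7 :: int"
  have "?h \<in> hom Z_squared (integer_mod_group 7)"
  proof (rule homI)
    fix u v
    have "((a + c) + 3 * (b + d)) mod 7 = ((a + 3 * b) mod 7 + (c + 3 * d) mod 7) mod 7" for a b c d :: int
      unfolding mod_add_eq by (simp add: algebra_simps)
    then show "?h (u \<otimes>\<^bsub>Z_squared\<^esub> v) = ?h u \<otimes>\<^bsub>integer_mod_group 7\<^esub> ?h v"
      by (cases u; cases v) (simp only: Z_squared_def mult_DirProd mult_integer_group
        mult_integer_mod_group case_prod_conv of_nat_numeral)
  qed (auto simp: carrier_integer_mod_group)
  then interpret h: group_hom Z_squared "integer_mod_group 7" ?h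
    using comm_group_Z_squared by (simp add: group_hom_def group_hom_axioms_def comm_group_def)
  show sub: "subgroup N_H Z_squared"
    unfolding N_H_def by (rule h.subgroup_kernel)
  \<comment> \<open>\<open>(x, 0)\<close> is a preimage of \<open>x\<close>; with surjectivity, the
    first isomorphism theorem applies to \<psi>.\<close>
  have "x \<in> ?h ` carrier Z_squared" if "x \<in> carrier (integer_mod_group 7)" for x
    using that by (intro image_eqI[of _ _ "(x, 0)"]) (auto simp: Z_squared_def carrier_integer_mod_group)
  then have "?h ` carrier Z_squared = carrier (integer_mod_group 7)"
    using h.hom_closed by blast
  then show "\<psi> \<in> iso (Z_squared Mod N_H) (integer_mod_group 7)"
    unfolding N_H_def \<psi>_def by (rule h.FactGroup_iso_set)
  \<comment> \<open>The homomorphism is constant on each coset, so its image there is a singleton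
    and \<open>the_elem\<close> in \<psi> returns that value.\<close>
  have "?h u = (x + 3 * y) mod 7" if "u \<in> N_H #>\<^bsub>Z_squared\<^esub> (x, y)" for u
  proof -
    from that obtain n where "n \<in> N_H" "u = n \<otimes>\<^bsub>Z_squared\<^esub> (x, y)"
      by (auto simp: r_coset_def)
    moreover from this have "?h u = ?h n \<otimes>\<^bsub>integer_mod_group 7\<^esub> ?h (x, y)"
      by (simp add: N_H_def kernel_def Z_squared_def del: mult_integer_mod_group)
         (use h.hom_mult in \<open>simp add: Z_squared_def\<close>)
    ultimately show ?thesis by (auto simp: N_H_def kernel_def)
  qed
  moreover have "(x, y) \<in> N_H #>\<^bsub>Z_squared\<^esub> (x, y)"
    using group.rcos_self[OF comm_group.axioms(2)[OF comm_group_Z_squared] _ sub]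
    by (simp add: Z_squared_def)
  ultimately have "?h ` (N_H #>\<^bsub>Z_squared\<^esub> (x, y)) = {(x + 3 * y) mod 7}"
    by (auto simp: image_iff)
  then show "\<psi> (N_H #>\<^bsub>Z_squared\<^esub> (x, y)) = (x + 3 * y) mod 7"
    unfolding \<psi>_def by simp
qed

text \<open>Everything is transported along the isomorphism with \<open>C_7\<close>, which sends the
  first components of the three generators to 1, \<open>1 + 3 = 4\<close> and 3.\<close>

lemma honeycomb_N_H:
  shows "finite_index_sublattice N_H" and "nondegenerate N_H"
    and "\<exists>\<phi> \<in> iso (honeycomb_group N_H) G_H. \<phi> ` honeycomb_S N_H = S_H"
    and "digraph_iso (honeycomb_quotient N_H) (Cay G_H S_H)"
proof -
  note sub = N_H_iso(1)
  obtain \<psi> where iso: "\<psi> \<in> iso (Z_squared Mod N_H) (integer_mod_group 7)"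
    and \<psi>: "\<And>x y. \<psi> (N_H #>\<^bsub>Z_squared\<^esub> (x, y)) = (x + 3 * y) mod 7"
    using N_H_iso(2,3) by blast
  have hom: "\<psi> \<in> hom (Z_squared Mod N_H) (integer_mod_group 7)"
    and bij: "bij_betw \<psi> (carrier (Z_squared Mod N_H)) (carrier (integer_mod_group 7))"
    using iso by (auto simp: iso_def)
  interpret A: comm_group "Z_squared Mod N_H" by (rule comm_group_honeycomb[OF sub])
  have "finite (carrier (Z_squared Mod N_H))"
    using bij_betw_finite[OF bij] by (simp add: carrier_C7)
  with sub show "finite_index_sublattice N_H"
    by (simp add: finite_index_sublattice_def FactGroup_def)
  let ?v1 = "N_H #>\<^bsub>Z_squared\<^esub> (1, 0)" and ?v2 = "N_H #>\<^bsub>Z_squared\<^esub> (0, 1)"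
  let ?X = "{?v1, ?v1 \<otimes>\<^bsub>Z_squared Mod N_H\<^esub> ?v2, ?v2}"
  have X: "?X \<subseteq> carrier (Z_squared Mod N_H)"
    by (rule honeycomb_gens_in_quotient[OF sub])
  have im: "\<psi> ` ?X = {1, 4, 3}"
    using hom_mult[OF hom coset_in_quotient[OF sub] coset_in_quotient[OF sub], of "(1, 0)" "(0, 1)"]
    by (simp add: \<psi>)
  have inj: "inj_on \<psi> (carrier (Z_squared Mod N_H))"
    using bij by (simp add: bij_betw_def)
  have "card ?X = 3"
    using card_image[OF inj_on_subset[OF inj X]] im by simp
  moreover have "sidon (Z_squared Mod N_H) ?X"
    using sidon_if_image_sidon[OF hom inj X] sidon_C7 im by simp
  ultimately show "nondegenerate N_H"
    using nondegenerate_iff_sidon[OF sub] by blast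
  have iso2: "map_prod \<psi> id \<in> iso (honeycomb_group N_H) G_H"
    unfolding honeycomb_group_def G_H_def
    using gen_dihedral_iso[OF A.is_group group_integer_mod_group iso] .
  have S: "honeycomb_S N_H = ?X \<times> {1}"
    by (auto simp: honeycomb_S_def honeycomb_gens_def)
  have S_im: "map_prod \<psi> id ` honeycomb_S N_H = S_H"
    unfolding S S_H_eq im[symmetric] by (auto simp: image_iff)
  show "\<exists>\<phi> \<in> iso (honeycomb_group N_H) G_H. \<phi> ` honeycomb_S N_H = S_H"
    using iso2 S_im by blast
  have group: "group (honeycomb_group N_H)"
    unfolding honeycomb_group_def by (rule group_gen_dihedral[OF A.comm_group_axioms])
  have "honeycomb_S N_H \<subseteq> carrier (honeycomb_group N_H)"
    using X unfolding S honeycomb_group_def carrier_gen_dihedral by blast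
  from digraph_iso_Cay[OF group this iso2] show "digraph_iso (honeycomb_quotient N_H) (Cay G_H S_H)"
    unfolding S_im honeycomb_quotient_def .
qed


section \<open>Separation numbers\<close>

lemma sep_G_H: "sep 4 G_H = 2"
  unfolding sep_def
proof (rule cInf_eq_minimum)
  let ?Y = "[(0, 0), (1, 0)] :: (int \<times> int) list"
  \<comment> \<open>One cyclic row of values per parity. Right multiplication by
    \<open>(1, 0)\<close> steps forward in the even row and backward in the odd one; the pairs read
    off are all 16 over four letters except \<open>00\<close> and \<open>11\<close>.\<close>
  let ?f = "\<lambda>(x, e :: int). (if e = 0 then [1 :: nat, 3, 3, 0, 2, 2, 0] else [3, 2, 1, 2, 3, 0, 1]) ! nat x"
  have "pattern G_H ?Y" by (simp add: pattern_def carrier_G_H)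
  moreover have "?f ` carrier G_H \<subseteq> {..<4 :: nat}" by (simp add: carrier_G_H)
  \<comment> \<open>Injectivity is checked by evaluating the map: its image has as many elements as
    the carrier.\<close>
  moreover have "separating G_H ?f ?Y"
    unfolding separating_def carrier_G_H
    by (rule eq_card_imp_inj_on, simp) (simp add: G_H_def gen_dihedral_def carrier_C7)
  ultimately show "2 \<in> {length Y | Y. pattern G_H Y \<and>
      (\<exists>f. f ` carrier G_H \<subseteq> {..<4} \<and> separating G_H f Y)}"
    by (intro CollectI exI[of _ ?Y]) auto
next
  fix n assume "n \<in> {length Y | Y. pattern G_H Y \<and>
      (\<exists>f. f ` carrier G_H \<subseteq> {..<4} \<and> separating G_H f Y)}"
  then have "14 \<le> (4 :: nat) ^ n"
    using order_le_power_separating[OF group_G_H] by (auto simp: order_G_H carrier_G_H)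
  moreover have "(4 :: nat) ^ n \<le> 4 ^ 1" if "n \<le> 1"
    using that by (intro power_increasing) auto
  ultimately show "2 \<le> n" by (cases "n \<le> 1") auto
qed

lemma csep_G_H: "csep 4 G_H S_H = 4"
  unfolding csep_def
proof (rule cInf_eq_minimum)
  let ?Y = "[(0, 0), (1, 1), (4, 1), (3, 1)] :: (int \<times> int) list"
  \<comment> \<open>Only the letters 0 and 1 occur: on four positions they give
    \<open>2^4 = 16\<close> words, and 14 of them are used, all but \<open>0111\<close> and
    \<open>1000\<close>.\<close>
  let ?f = "\<lambda>(x, e :: int). (if e = 0 then [1 :: nat, 1, 0, 1, 0, 0, 0] else [0, 1, 0, 0, 1, 1, 1]) ! nat x"
  \<comment> \<open>The window is a star: each generator is adjacent to the identity.\<close>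
  have "connected (Cay G_H S_H \<restriction> set ?Y)"
  proof (rule connectedI_root[of "(0, 0)"])
    fix u assume u: "u \<in> verts (Cay G_H S_H \<restriction> set ?Y)"
    show "((0, 0), u) \<in> rtrancl_on (verts (Cay G_H S_H \<restriction> set ?Y)) ((arcs_ends (Cay G_H S_H \<restriction> set ?Y))\<^sup>s)"
    proof (cases "u = (0, 0)")
      case False
      with u have "((0, 0), u) \<in> arcs (Cay G_H S_H \<restriction> set ?Y)"
        by (auto simp: induce_subgraph_def in_arcs_Cay S_H_elements G_H_def gen_dihedral_def)
      then have "((0, 0), u) \<in> (arcs_ends (Cay G_H S_H \<restriction> set ?Y))\<^sup>s"
        by (force simp: symcl_def arcs_ends_conv induce_subgraph_def)
      then show ?thesis
        using u by (intro rtrancl_on_into_rtrancl_on[OF rtrancl_on_refl]) auto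
    qed simp
  qed simp
  then have "cayley_window G_H S_H ?Y"
    by (simp add: cayley_window_def pattern_def carrier_G_H S_H_elements)
       (simp add: G_H_def gen_dihedral_def)
  moreover have "?f ` carrier G_H \<subseteq> {..<4 :: nat}" by (simp add: carrier_G_H)
  moreover have "separating G_H ?f ?Y"
    unfolding separating_def carrier_G_H
    by (rule eq_card_imp_inj_on, simp) (simp add: G_H_def gen_dihedral_def carrier_C7)
  ultimately show "4 \<in> {length Y | Y. cayley_window G_H S_H Y \<and>
      (\<exists>f. f ` carrier G_H \<subseteq> {..<4} \<and> separating G_H f Y)}"
    by (intro CollectI exI[of _ ?Y]) auto
next
  fix n assume "n \<in> {length Y | Y. cayley_window G_H S_H Y \<and>
      (\<exists>f. f ` carrier G_H \<subseteq> {..<4} \<and> separating G_H f Y)}"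
  then obtain Y where Y: "n = length Y" "cayley_window G_H S_H Y" by auto
  then have "insert (0, 0) S_H \<subseteq> set Y"
    by (auto simp: cayley_window_def G_H_def gen_dihedral_def)
  \<comment> \<open>The identity has parity 0 and the three generators have parity 1, so the
    inserted set has 4 elements.\<close>
  then have "card (insert (0, 0) S_H) \<le> card (set Y)" by (intro card_mono) auto
  also have "\<dots> \<le> length Y" by (rule card_length)
  finally show "4 \<le> n" using Y by (simp add: S_H_eq)
qed

theorem mainTheorem3:
  shows "(order G_H = 14 \<and> S_H = {(1, 1), (4, 1), (3, 1)}) \<and>
    (digraph_iso (Cay G_H S_H) heawood_graph \<and>
      connected (Cay G_H S_H) \<and> bipartite (Cay G_H S_H) \<and>
      trivalent (Cay G_H S_H) \<and> girth (Cay G_H S_H) = 6) \<and>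
    (finite_index_sublattice N_H \<and> nondegenerate N_H \<and>
      (\<exists>\<phi> \<in> iso (honeycomb_group N_H) G_H. \<phi> ` honeycomb_S N_H = S_H) \<and>
      digraph_iso (honeycomb_quotient N_H) (Cay G_H S_H) \<and>
      (\<forall>N. finite_index_sublattice N \<and> nondegenerate N \<longrightarrow> 14 \<le> order (honeycomb_group N))) \<and>
    (sep 4 G_H = 2 \<and> csep 4 G_H S_H = 4 \<and> csep 4 G_H S_H = 2 * sep 4 G_H)"
proof -
  have "bipartite (Cay G_H S_H)"
    using bipartite_Cay_gen_dihedral[of "integer_mod_group 7" "{1, 4, 3}"]
    by (simp add: G_H_def S_H_eq carrier_C7)
  moreover have "trivalent (Cay G_H S_H)"
    unfolding trivalent_def using out_degree_Cay[OF group_G_H S_H_subset] by (simp add: S_H_eq)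
  ultimately show ?thesis
    using order_G_H S_H_elements digraph_iso_heawood connected_Cay_G_H girth_Cay_G_H honeycomb_N_H
      nondegenerate_order_ge_14 sep_G_H csep_G_H by simp
qed

end
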